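(* There are universal constants $c,C>0$ such that for every integer $n\ge 3$ there is a function $F:\{\pm1\}^n\to\mathbb{R}$ for which the following holds. Let $\mathcal{F}=\{S\subseteq[n]:\hat F(S)\neq 0\}$, let $f:\{\pm1\}^n\to\mathbb{R}^{\mathcal{F}}$ be defined by $(f(x))_S=\hat F(S)\chi_S(x)$ for $S\in\mathcal{F}$, and define a norm on $\mathbb{R}^{\mathcal{F}}$ by $$\|v\|=\max_{z\in\{\pm1\}^n}\Big|\sum_{S\in\mathcal{F}}v_S\,\chi_S(z)\Big|.$$ Then $\hat F(\{j\})=\frac{1}{\sqrt n}$ for all $j\in[n]$, and for every $x\in\{\pm1\}^n$, $$\|f(x)\|=\max_{z\in\{\pm1\}^n}|F(z)|\le C\qquad\text{and}\qquad \|f_{\mathrm{lin}}(x)\|\ge \sqrt n\ge c\cdot\frac{\log|\mathcal{F}|}{\log\log|\mathcal{F}|}.$$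
   Context: For $S\subseteq[n]=\{1,\dots,n\}$, let $\chi_S(x)=\prod_{j\in S}x_j$ for $x\in\{\pm1\}^n$. Every function $g$ from $\{\pm1\}^n$ to a finite-dimensional real vector space can be uniquely written as $g(x)=\sum_{S\subseteq[n]}\hat g(S)\chi_S(x)$; the $\hat g(S)$ are its Fourier coefficients, and its linear part is $g_{\mathrm{lin}}(x)=\sum_{j=1}^n\hat g(\{j\})x_j$. The logarithm is the natural logarithm. Since every $\{j\}$ belongs to $\mathcal{F}$, we have $|\mathcal{F}|\ge n\ge 3$, so $\log\log|\mathcal{F}|>0$. *)

theory Defs
  imports "HOL-Analysis.Analysis" "HOL-Analysis.Finite_Function_Topology"
begin

text \<open>Points of the cube are extensional functions, so that there are exactly \<open>2 ^ n\<close> of them.\<close>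

definition cube :: "nat \<Rightarrow> (nat \<Rightarrow> real) set"
  where "cube n = {1..n} \<rightarrow>\<^sub>E {-1, 1}"

definition chi :: "nat set \<Rightarrow> (nat \<Rightarrow> real) \<Rightarrow> real"
  where "chi S x = (\<Prod>j\<in>S. x j)"

definition is_fourier_expansion ::
    "nat \<Rightarrow> ((nat \<Rightarrow> real) \<Rightarrow> 'v::real_vector) \<Rightarrow> (nat set \<Rightarrow> 'v) \<Rightarrow> bool"
  where "is_fourier_expansion n g a \<longleftrightarrow>
    (\<forall>x\<in>cube n. g x = (\<Sum>S\<in>Pow {1..n}. chi S x *\<^sub>R a S)) \<and> (\<forall>S. \<not> S \<subseteq> {1..n} \<longrightarrow> a S = 0)"

text \<open>The description is proper by \<open>ex1_fourier_expansion\<close> below.\<close>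

definition fourier :: "nat \<Rightarrow> ((nat \<Rightarrow> real) \<Rightarrow> 'v::real_vector) \<Rightarrow> nat set \<Rightarrow> 'v"
  where "fourier n g = (THE a. is_fourier_expansion n g a)"

definition linear_part :: "nat \<Rightarrow> ((nat \<Rightarrow> real) \<Rightarrow> 'v::real_vector) \<Rightarrow> (nat \<Rightarrow> real) \<Rightarrow> 'v"
  where "linear_part n g x = (\<Sum>j=1..n. x j *\<^sub>R fourier n g {j})"

definition spectrum :: "nat \<Rightarrow> ((nat \<Rightarrow> real) \<Rightarrow> real) \<Rightarrow> nat set set"
  where "spectrum n F = {S. S \<subseteq> {1..n} \<and> fourier n F S \<noteq> 0}"

text \<open>
  For a finite index set \<open>I\<close>, the space \<open>\<real>\<^sup>I\<close> is rendered as the subspace of those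
  \<open>v :: nat set \<Rightarrow>\<^sub>0 real\<close> with \<open>keys v \<subseteq> I\<close>. The norm used on it is \<open>spec_norm\<close>,
  not the \<open>norm\<close> that the library puts on this type.
\<close>

definition spec_map :: "nat \<Rightarrow> ((nat \<Rightarrow> real) \<Rightarrow> real) \<Rightarrow> (nat \<Rightarrow> real) \<Rightarrow> (nat set \<Rightarrow>\<^sub>0 real)"
  where "spec_map n F x =
    Abs_poly_mapping (\<lambda>S. if S \<in> spectrum n F then fourier n F S * chi S x else 0)"

definition spec_norm :: "nat \<Rightarrow> nat set set \<Rightarrow> (nat set \<Rightarrow>\<^sub>0 real) \<Rightarrow> real"
  where "spec_norm n I v = Max ((\<lambda>z. \<bar>\<Sum>S\<in>I. Poly_Mapping.lookup v S * chi S z\<bar>) ` cube n)"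

lemma finite_cube [simp]: "finite (cube n)"
  by (auto simp: cube_def intro: finite_PiE)

lemma cube_nonempty [simp]: "cube n \<noteq> {}"
  by (auto simp: cube_def PiE_eq_empty_iff)

lemma sum_chi_mult:
  assumes "S \<subseteq> {1..n}" "T \<subseteq> {1..n}"
  shows "(\<Sum>x\<in>cube n. chi S x * chi T x) = (if S = T then 2 ^ n else 0)"
proof -
  define h where "h j y = (if j \<in> S then y else 1) * (if j \<in> T then y else (1::real))" for j y
  have chi_eq: "chi U x = (\<Prod>j=1..n. if j \<in> U then x j else 1)" if "U \<subseteq> {1..n}" for U x
    using that unfolding chi_def by (subst prod.inter_restrict[symmetric]) (auto simp: Int_absorb1)
  have "(\<Sum>x\<in>cube n. chi S x * chi T x) = (\<Sum>x\<in>{1..n} \<rightarrow>\<^sub>E {-1,1}. \<Prod>j=1..n. h j (x j))"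
    using assms by (simp add: chi_eq h_def cube_def prod.distrib)
  also have "\<dots> = (\<Prod>j=1..n. \<Sum>y\<in>{-1,1}. h j y)"
    by (rule prod_sum_PiE[symmetric]) auto
  also have "\<dots> = (\<Prod>j=1..n. if j \<in> S \<longleftrightarrow> j \<in> T then 2 else 0)"
    by (rule prod.cong) (auto simp: h_def)
  also have "\<dots> = (if S = T then 2 ^ n else 0)"
  proof (cases "S = T")
    case False
    then obtain j where "j \<in> {1..n}" "(j \<in> S) \<noteq> (j \<in> T)"
      using assms by blast
    with False show ?thesis
      by (auto intro!: prod_zero)
  qed simp
  finally show ?thesis .
qed

lemma sum_chi_mult_dual:
  assumes "x \<in> cube n" "y \<in> cube n"
  shows "(\<Sum>S\<in>Pow {1..n}. chi S x * chi S y) = (if x = y then 2 ^ n else 0)"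
proof -
  have "(\<Sum>S\<in>Pow {1..n}. chi S x * chi S y) = (\<Prod>j=1..n. x j * y j + 1)"
    by (subst prod_add) (simp_all only: finite_atLeastAtMost chi_def prod.distrib prod.neutral_const mult_1_right)
  also have "\<dots> = (if x = y then 2 ^ n else 0)"
  proof (cases "x = y")
    case True
    have "x j * x j + 1 = 2" if "j \<in> {1..n}" for j
    proof -
      have "x j \<in> {-1, 1}" using assms(1) that unfolding cube_def by (rule PiE_mem)
      then show ?thesis by auto
    qed
    then show ?thesis using True by simp
  next
    case False
    then obtain j where j: "j \<in> {1..n}" "x j \<noteq> y j"
      using assms unfolding cube_def by (meson PiE_ext)
    have "x j \<in> {-1, 1}" "y j \<in> {-1, 1}"
      using PiE_mem[OF _ j(1)] assms unfolding cube_def by blast+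
    then have "x j * y j + 1 = 0" using j by auto
    then show ?thesis using False j by (auto intro!: prod_zero)
  qed
  finally show ?thesis .
qed

lemma fourier_expansion_unique:
  assumes "is_fourier_expansion n g a"
  shows "a S = (if S \<subseteq> {1..n} then (1 / 2 ^ n) *\<^sub>R (\<Sum>x\<in>cube n. chi S x *\<^sub>R g x) else 0)"
proof (cases "S \<subseteq> {1..n}")
  case True
  have "(\<Sum>x\<in>cube n. chi S x *\<^sub>R g x) =
      (\<Sum>x\<in>cube n. \<Sum>T\<in>Pow {1..n}. (chi S x * chi T x) *\<^sub>R a T)"
    using assms by (simp add: is_fourier_expansion_def scaleR_sum_right)
  also have "\<dots> = (\<Sum>T\<in>Pow {1..n}. (\<Sum>x\<in>cube n. chi S x * chi T x) *\<^sub>R a T)"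
    by (subst sum.swap) (simp add: scaleR_sum_left)
  also have "\<dots> = (\<Sum>T\<in>Pow {1..n}. if S = T then 2 ^ n *\<^sub>R a T else 0)"
    by (rule sum.cong) (use True in \<open>auto simp: sum_chi_mult\<close>)
  also have "\<dots> = 2 ^ n *\<^sub>R a S"
    using True by (simp add: sum.delta')
  finally show ?thesis using True by simp
qed (use assms in \<open>auto simp: is_fourier_expansion_def\<close>)

lemma fourier_expansion_exists:
  "is_fourier_expansion n g
    (\<lambda>S. if S \<subseteq> {1..n} then (1 / 2 ^ n) *\<^sub>R (\<Sum>x\<in>cube n. chi S x *\<^sub>R g x) else 0)"
  unfolding is_fourier_expansion_def
proof (intro conjI ballI allI impI)
  fix x assume x: "x \<in> cube n"
  have "(\<Sum>S\<in>Pow {1..n}. chi S x *\<^sub>R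
        (if S \<subseteq> {1..n} then (1 / 2 ^ n) *\<^sub>R (\<Sum>y\<in>cube n. chi S y *\<^sub>R g y) else 0)) =
      (\<Sum>S\<in>Pow {1..n}. \<Sum>y\<in>cube n. (1 / 2 ^ n) *\<^sub>R (chi S x * chi S y) *\<^sub>R g y)"
    by (rule sum.cong) (auto simp: scaleR_sum_right mult_ac)
  also have "\<dots> = (\<Sum>y\<in>cube n. (1 / 2 ^ n) *\<^sub>R (\<Sum>S\<in>Pow {1..n}. chi S x * chi S y) *\<^sub>R g y)"
    by (subst sum.swap) (simp add: scaleR_sum_left scaleR_sum_right)
  also have "\<dots> = (\<Sum>y\<in>cube n. if x = y then g y else 0)"
    by (rule sum.cong) (use x in \<open>auto simp: sum_chi_mult_dual simp del: One_nat_def\<close>)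
  also have "\<dots> = g x"
    using x by (simp add: sum.delta')
  finally show "g x = (\<Sum>S\<in>Pow {1..n}. chi S x *\<^sub>R
        (if S \<subseteq> {1..n} then (1 / 2 ^ n) *\<^sub>R (\<Sum>y\<in>cube n. chi S y *\<^sub>R g y) else 0))" ..
qed simp

lemma ex1_fourier_expansion: "\<exists>!a. is_fourier_expansion n g a"
proof (rule ex1I, rule fourier_expansion_exists)
  fix a assume "is_fourier_expansion n g a"
  from fourier_expansion_unique[OF this]
  show "a = (\<lambda>S. if S \<subseteq> {1..n} then (1 / 2 ^ n) *\<^sub>R (\<Sum>x\<in>cube n. chi S x *\<^sub>R g x) else 0)"
    by (rule ext)
qed

lemma is_fourier_expansion_fourier: "is_fourier_expansion n g (fourier n g)"
  unfolding fourier_def by (rule theI'[OF ex1_fourier_expansion])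

lemma finite_spectrum [simp]: "finite (spectrum n F)"
  by (rule finite_subset[of _ "Pow {1..n}"]) (auto simp: spectrum_def)

lemma lookup_spec_map:
  "Poly_Mapping.lookup (spec_map n F x) S = (if S \<in> spectrum n F then fourier n F S * chi S x else 0)"
  unfolding spec_map_def
  by (subst lookup_Abs_poly_mapping) (auto intro: finite_subset[OF _ finite_spectrum[of n F]])

lemma lookup_scaleR: "Poly_Mapping.lookup (c *\<^sub>R v) S = c *\<^sub>R Poly_Mapping.lookup v S"
  unfolding scaleR_poly_mapping_def
  by (subst lookup_Abs_poly_mapping)
    (auto intro: finite_subset[OF _ finite_keys[of v]] simp: in_keys_iff)

lemma spec_norm_triangle: "spec_norm n I (v + w) \<le> spec_norm n I v + spec_norm n I w"
  unfolding spec_norm_def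
proof (rule Max.boundedI)
  fix r assume "r \<in> (\<lambda>z. \<bar>\<Sum>S\<in>I. Poly_Mapping.lookup (v + w) S * chi S z\<bar>) ` cube n"
  then obtain z where z: "z \<in> cube n" and r: "r = \<bar>\<Sum>S\<in>I. Poly_Mapping.lookup (v + w) S * chi S z\<bar>"
    by blast
  have "r \<le> \<bar>\<Sum>S\<in>I. Poly_Mapping.lookup v S * chi S z\<bar> + \<bar>\<Sum>S\<in>I. Poly_Mapping.lookup w S * chi S z\<bar>"
    unfolding r by (simp add: Poly_Mapping.lookup_add ring_distribs sum.distrib)
  also have "\<dots> \<le> Max ((\<lambda>z. \<bar>\<Sum>S\<in>I. Poly_Mapping.lookup v S * chi S z\<bar>) ` cube n)
      + Max ((\<lambda>z. \<bar>\<Sum>S\<in>I. Poly_Mapping.lookup w S * chi S z\<bar>) ` cube n)"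
    using z by (intro add_mono Max_ge) auto
  finally show "r \<le> Max ((\<lambda>z. \<bar>\<Sum>S\<in>I. Poly_Mapping.lookup v S * chi S z\<bar>) ` cube n)
      + Max ((\<lambda>z. \<bar>\<Sum>S\<in>I. Poly_Mapping.lookup w S * chi S z\<bar>) ` cube n)" .
qed auto

lemma spec_norm_scaleR: "spec_norm n I (c *\<^sub>R v) = \<bar>c\<bar> * spec_norm n I v"
proof -
  have "mono (\<lambda>r::real. \<bar>c\<bar> * r)"
    by (auto intro!: monoI mult_left_mono)
  then have "\<bar>c\<bar> * spec_norm n I v = Max ((\<lambda>r. \<bar>c\<bar> * r) ` (\<lambda>z. \<bar>\<Sum>S\<in>I. Poly_Mapping.lookup v S * chi S z\<bar>) ` cube n)"
    unfolding spec_norm_def by (rule mono_Max_commute) auto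
  also have "(\<lambda>r. \<bar>c\<bar> * r) ` (\<lambda>z. \<bar>\<Sum>S\<in>I. Poly_Mapping.lookup v S * chi S z\<bar>) ` cube n
      = (\<lambda>z. \<bar>\<Sum>S\<in>I. Poly_Mapping.lookup (c *\<^sub>R v) S * chi S z\<bar>) ` cube n"
    by (simp add: lookup_scaleR image_image abs_mult[symmetric] sum_distrib_left mult.assoc)
  finally show ?thesis
    by (simp add: spec_norm_def)
qed

lemma spec_norm_eq_0_iff:
  assumes I: "I \<subseteq> Pow {1..n}" and v: "Poly_Mapping.keys v \<subseteq> I"
  shows "spec_norm n I v = 0 \<longleftrightarrow> v = 0"
proof
  assume *: "spec_norm n I v = 0"
  have zero: "(\<Sum>S\<in>I. Poly_Mapping.lookup v S * chi S z) = 0" if "z \<in> cube n" for z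
  proof -
    have "\<bar>\<Sum>S\<in>I. Poly_Mapping.lookup v S * chi S z\<bar> \<le> spec_norm n I v"
      unfolding spec_norm_def using that by (intro Max_ge) auto
    with * show ?thesis by simp
  qed
  have out: "Poly_Mapping.lookup v S = 0" if "S \<notin> I" for S
    using v that by (auto simp: in_keys_iff)
  have "is_fourier_expansion n (\<lambda>_. 0) (Poly_Mapping.lookup v)"
    unfolding is_fourier_expansion_def
  proof safe
    fix z assume z: "z \<in> cube n"
    have "(\<Sum>S\<in>Pow {1..n}. chi S z *\<^sub>R Poly_Mapping.lookup v S) = (\<Sum>S\<in>I. chi S z *\<^sub>R Poly_Mapping.lookup v S)"
      using I out by (intro sum.mono_neutral_right) auto
    then show "0 = (\<Sum>S\<in>Pow {1..n}. chi S z *\<^sub>R Poly_Mapping.lookup v S)"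
      using zero[OF z] by (simp add: mult.commute)
  qed (use I out in blast)
  from fourier_expansion_unique[OF this] show "v = 0"
    by (intro poly_mapping_eqI) simp
next
  assume "v = 0"
  then show "spec_norm n I v = 0"
    by (simp add: spec_norm_def image_constant_conv)
qed

end

theory Submission
  imports Defs
begin

text \<open>
  The function is the imaginary part of the Riesz product
  \<open>\<Prod>j. (1 + \<i> x\<^sub>j / sqrt n)\<close>, truncated to degree \<open>d = \<lceil>3 sqrt n\<rceil>\<close>. The product has modulus
  \<open>(1 + 1/n)\<^bsup>n/2\<^esup>\<close>, and its coefficients of degree \<open>k\<close> have modulus \<open>n\<^bsup>-k/2\<^esup>\<close>, so the weighted
  count \<open>\<Sum>S. t\<^bsup>card S\<^esup> = (1 + t)\<^sup>n\<close> shows that the discarded part is bounded by \<open>1\<close> (take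
  \<open>t = e / sqrt n\<close>) and that at most \<open>e n\<^sup>d\<close> characters survive (take \<open>t = 1 / n\<close>).
\<close>

section \<open>Fourier coefficients and the spectral norm\<close>

lemma fourier_eqI:
  assumes "is_fourier_expansion n g a"
  shows "fourier n g = a"
  using fourier_expansion_unique[OF is_fourier_expansion_fourier] fourier_expansion_unique[OF assms]
  by (intro ext) (simp only:)

lemma fourier_outside: "\<not> S \<subseteq> {1..n} \<Longrightarrow> fourier n g S = 0"
  using is_fourier_expansion_fourier[of n g] unfolding is_fourier_expansion_def by blast

lemma fourier_sum:
  fixes F :: "(nat \<Rightarrow> real) \<Rightarrow> real"
  assumes "z \<in> cube n"
  shows "F z = (\<Sum>S\<in>spectrum n F. fourier n F S * chi S z)"
proof -
  have "F z = (\<Sum>S\<in>Pow {1..n}. chi S z *\<^sub>R fourier n F S)"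
    using is_fourier_expansion_fourier[of n F] assms unfolding is_fourier_expansion_def by blast
  also have "\<dots> = (\<Sum>S\<in>spectrum n F. chi S z *\<^sub>R fourier n F S)"
    by (rule sum.mono_neutral_right) (auto simp: spectrum_def)
  finally show ?thesis by (simp add: mult.commute)
qed

text \<open>The group operation of the cube. The restriction makes the product
  \<open>undefined\<close> off \<open>{1..n}\<close>, like every point of \<open>cube n\<close>, so
  that translations map the cube to itself.\<close>

definition pointwise :: "nat \<Rightarrow> (nat \<Rightarrow> real) \<Rightarrow> (nat \<Rightarrow> real) \<Rightarrow> nat \<Rightarrow> real"
  where "pointwise n x z = (\<lambda>j\<in>{1..n}. x j * z j)"

lemma cube_coord:
  assumes "x \<in> cube n" "j \<in> {1..n}"
  shows "x j = -1 \<or> x j = 1"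
  using PiE_mem[OF assms[unfolded cube_def]] by simp

lemma cube_coord_sq: "x \<in> cube n \<Longrightarrow> j \<in> {1..n} \<Longrightarrow> x j * x j = 1"
  by (drule (1) cube_coord) auto

lemma pointwise_in_cube:
  assumes "x \<in> cube n" "z \<in> cube n"
  shows "pointwise n x z \<in> cube n"
  unfolding pointwise_def cube_def restrict_PiE_iff
proof
  fix j assume "j \<in> {1..n}"
  with cube_coord[OF assms(1) this] cube_coord[OF assms(2) this]
  show "x j * z j \<in> {-1, 1}" by auto
qed

lemma pointwise_involution:
  assumes "x \<in> cube n" "z \<in> cube n"
  shows "pointwise n x (pointwise n x z) = z"
proof
  fix j show "pointwise n x (pointwise n x z) j = z j"
  proof (cases "j \<in> {1..n}")
    case True
    then have "pointwise n x (pointwise n x z) j = (x j * x j) * z j"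
      by (simp add: pointwise_def)
    then show ?thesis by (simp add: cube_coord_sq[OF assms(1) True])
  next
    case False
    with assms(2) have "z j = undefined"
      unfolding cube_def by (rule PiE_arb)
    with False show ?thesis unfolding pointwise_def by (simp only: restrict_apply if_False)
  qed
qed

lemma pointwise_image_cube:
  assumes "x \<in> cube n"
  shows "pointwise n x ` cube n = cube n"
proof
  show "cube n \<subseteq> pointwise n x ` cube n"
    using pointwise_involution[OF assms] pointwise_in_cube[OF assms] by (metis image_eqI subsetI)
qed (use pointwise_in_cube[OF assms] in blast)

lemma chi_pointwise:
  assumes "S \<subseteq> {1..n}"
  shows "chi S (pointwise n x z) = chi S x * chi S z"
  unfolding chi_def prod.distrib[symmetric]
  using assms by (intro prod.cong) (auto simp: pointwise_def)

text \<open>Translating by \<open>x\<close> permutes the cube, so the norm of \<open>f x\<close> does not depend on \<open>x\<close>.\<close>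

lemma spec_norm_spec_map:
  assumes x: "x \<in> cube n"
  shows "spec_norm n (spectrum n F) (spec_map n F x) = Max ((\<lambda>z. \<bar>F z\<bar>) ` cube n)"
proof -
  have "(\<Sum>S\<in>spectrum n F. Poly_Mapping.lookup (spec_map n F x) S * chi S z) = F (pointwise n x z)"
    if "z \<in> cube n" for z
    unfolding fourier_sum[OF pointwise_in_cube[OF x that], of F]
    by (rule sum.cong) (auto simp: lookup_spec_map chi_pointwise spectrum_def)
  then have "(\<lambda>z. \<bar>\<Sum>S\<in>spectrum n F. Poly_Mapping.lookup (spec_map n F x) S * chi S z\<bar>) ` cube n
      = (\<lambda>z. \<bar>F z\<bar>) ` pointwise n x ` cube n"
    by (simp add: image_image)
  then show ?thesis
    unfolding spec_norm_def pointwise_image_cube[OF x] by simp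
qed

text \<open>The formula defining \<open>spec_map\<close> already is a Fourier expansion, with the
  coefficient at S a multiple of the S-th basis vector, so uniqueness applies. Hence the linear part
  of \<open>spec_map n F\<close> lives on singleton coordinates only.\<close>

lemma fourier_spec_map:
  "fourier n (spec_map n F) S = Poly_Mapping.single S (fourier n F S)"
proof -
  have "is_fourier_expansion n (spec_map n F) (\<lambda>S. Poly_Mapping.single S (fourier n F S))"
    unfolding is_fourier_expansion_def
  proof (intro conjI ballI allI impI)
    fix x
    show "spec_map n F x = (\<Sum>S\<in>Pow {1..n}. chi S x *\<^sub>R Poly_Mapping.single S (fourier n F S))"
    proof (rule poly_mapping_eqI)
      fix T
      have "Poly_Mapping.lookup (\<Sum>S\<in>Pow {1..n}. chi S x *\<^sub>R Poly_Mapping.single S (fourier n F S)) T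
          = (\<Sum>S\<in>Pow {1..n}. if S = T then chi S x * fourier n F S else 0)"
        unfolding lookup_sum lookup_scaleR
        by (rule sum.cong) (auto simp: lookup_single when_def)
      also have "\<dots> = (if T \<in> Pow {1..n} then chi T x * fourier n F T else 0)"
        by (subst sum.delta) auto
      finally show "Poly_Mapping.lookup (spec_map n F x) T = Poly_Mapping.lookup
          (\<Sum>S\<in>Pow {1..n}. chi S x *\<^sub>R Poly_Mapping.single S (fourier n F S)) T"
        by (auto simp: lookup_spec_map spectrum_def)
    qed
  qed (simp add: fourier_outside)
  from fun_cong[OF fourier_eqI[OF this]] show ?thesis .
qed

text \<open>The lower bound is attained at \<open>z = x\<close>.\<close>

lemma spec_norm_linear_part_spec_map_ge:
  assumes x: "x \<in> cube n"
  shows "\<bar>\<Sum>j=1..n. fourier n F {j}\<bar> \<le> spec_norm n (spectrum n F) (linear_part n (spec_map n F) x)"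
proof -
  let ?L = "linear_part n (spec_map n F) x"
  have lookup: "Poly_Mapping.lookup ?L S = (\<Sum>j=1..n. if S = {j} then x j * fourier n F {j} else 0)" for S
    unfolding linear_part_def fourier_spec_map lookup_sum lookup_scaleR
    by (rule sum.cong) (auto simp: lookup_single when_def)
  have "(\<Sum>S\<in>spectrum n F. Poly_Mapping.lookup ?L S * chi S x)
      = (\<Sum>j=1..n. \<Sum>S\<in>spectrum n F. if S = {j} then x j * fourier n F {j} * chi S x else 0)"
    unfolding lookup sum_distrib_right by (subst sum.swap) (intro sum.cong refl, simp)
  also have "\<dots> = (\<Sum>j=1..n. fourier n F {j})"
  proof (rule sum.cong)
    fix j assume j: "j \<in> {1..n}"
    have "(\<Sum>S\<in>spectrum n F. if S = {j} then x j * fourier n F {j} * chi S x else 0)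
        = (if {j} \<in> spectrum n F then x j * fourier n F {j} * chi {j} x else 0)"
      by (subst sum.delta) auto
    \<comment> \<open>If \<open>{j}\<close> is not in the spectrum, its coefficient is 0, so both
      cases give the same value.\<close>
    also have "\<dots> = (x j * x j) * fourier n F {j}"
      using j by (auto simp: chi_def spectrum_def)
    finally show "(\<Sum>S\<in>spectrum n F. if S = {j} then x j * fourier n F {j} * chi S x else 0)
        = fourier n F {j}"
      by (simp add: cube_coord_sq[OF x j])
  qed simp
  finally show ?thesis
    unfolding spec_norm_def using x by (intro Max_ge) (auto intro!: image_eqI[of _ _ x])
qed

section \<open>The truncated Riesz product\<close>

text \<open>Stated over a general ring because it serves twice: over the complex numbers to factor
  the Riesz product, over the reals to count sets by size.\<close>

lemma sum_Pow_prod: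
  fixes f :: "'a \<Rightarrow> 'b::comm_ring_1"
  assumes "finite A"
  shows "(\<Sum>S\<in>Pow A. \<Prod>j\<in>S. f j) = (\<Prod>j\<in>A. 1 + f j)"
  using prod_add[OF assms, of f "\<lambda>_. 1"] by (simp add: add.commute)

lemma sum_Pow_power_card:
  fixes t :: "'b::comm_ring_1"
  assumes "finite A"
  shows "(\<Sum>S\<in>Pow A. t ^ card S) = (1 + t) ^ card A"
  using sum_Pow_prod[OF assms, of "\<lambda>_. t"] by simp

lemma one_plus_power_le_exp:
  fixes t :: real
  assumes "0 \<le> t"
  shows "(1 + t) ^ n \<le> exp (real n * t)"
  unfolding exp_of_nat_mult using assms by (intro power_mono exp_ge_add_one_self) auto

text \<open>The coefficient at S of the imaginary part of the Riesz product: zero for even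
  \<open>card S\<close>, and of alternating sign for odd \<open>card S\<close>, starting with +. The
  factor \<i> keeps the product bounded: with real factors 1 + x_j / sqrt n it would reach (1 + 1 /
  sqrt n)^n.\<close>

definition riesz :: "nat \<Rightarrow> nat set \<Rightarrow> real"
  where "riesz n S = Im ((\<i> / sqrt (real n)) ^ card S)"

text \<open>The coefficients vanish off the subsets of \<open>{1..n}\<close>, as
  \<open>is_fourier_expansion\<close> demands, so they are literally the value of
  \<open>fourier\<close>.\<close>

definition trunc :: "nat \<Rightarrow> nat \<Rightarrow> nat set \<Rightarrow> real"
  where "trunc n d S = (if S \<subseteq> {1..n} \<and> card S \<le> d then riesz n S else 0)"

definition trunc_fun :: "nat \<Rightarrow> nat \<Rightarrow> (nat \<Rightarrow> real) \<Rightarrow> real"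
  where "trunc_fun n d x = (\<Sum>S\<in>Pow {1..n}. chi S x *\<^sub>R trunc n d S)"

lemma fourier_trunc_fun: "fourier n (trunc_fun n d) = trunc n d"
  by (rule fourier_eqI) (auto simp: is_fourier_expansion_def trunc_fun_def trunc_def)

lemma riesz_singleton: "riesz n {j} = 1 / sqrt (real n)"
  by (simp add: riesz_def)

lemma abs_riesz_le: "\<bar>riesz n S\<bar> \<le> (1 / sqrt (real n)) ^ card S"
proof -
  have "\<bar>riesz n S\<bar> \<le> cmod ((\<i> / sqrt (real n)) ^ card S)"
    unfolding riesz_def by (rule abs_Im_le_cmod)
  then show ?thesis by (simp add: norm_power norm_divide)
qed

lemma abs_chi:
  assumes "x \<in> cube n" "S \<subseteq> {1..n}"
  shows "\<bar>chi S x\<bar> = 1"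
  unfolding chi_def abs_prod
proof (rule prod.neutral, rule ballI)
  fix j assume "j \<in> S"
  then have "x j = -1 \<or> x j = 1" using cube_coord[OF assms(1)] assms(2) by (meson subsetD)
  then show "\<bar>x j\<bar> = 1" by auto
qed

text \<open>Since chi is real, it passes through Im, and the sum is the imaginary part of a product
  whose n factors have modulus sqrt (1 + 1/n).\<close>

lemma abs_riesz_product_le:
  assumes x: "x \<in> cube n" and n: "n > 0"
  shows "\<bar>\<Sum>S\<in>Pow {1..n}. chi S x * riesz n S\<bar> \<le> exp 1"
proof -
  define w where "w = \<i> / sqrt (real n)"
  have "Im (\<Prod>j\<in>S. of_real (x j) * w) = chi S x * riesz n S" for S
  proof -
    have "(\<Prod>j\<in>S. of_real (x j) * w) = of_real (chi S x) * w ^ card S"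
      by (simp add: chi_def prod.distrib)
    then show ?thesis by (simp add: riesz_def w_def)
  qed
  then have "(\<Sum>S\<in>Pow {1..n}. chi S x * riesz n S)
      = Im (\<Sum>S\<in>Pow {1..n}. \<Prod>j\<in>S. of_real (x j) * w)"
    by (simp only: Im_sum)
  also have "\<bar>\<dots>\<bar> \<le> cmod (\<Prod>j=1..n. 1 + of_real (x j) * w)"
    by (subst sum_Pow_prod) (simp_all add: abs_Im_le_cmod)
  also have "\<dots> = (\<Prod>j=1..n. cmod (1 + of_real (x j) * w))"
    by (simp add: prod_norm)
  also have "\<dots> \<le> (\<Prod>j=1..n. 1 + 1 / real n)"
  proof (intro prod_mono conjI)
    fix j assume j: "j \<in> {1..n}"
    have "x j ^ 2 = 1" using cube_coord_sq[OF x j] by (simp add: power2_eq_square)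
    then have "cmod (1 + of_real (x j) * w) = sqrt (1 + 1 / real n)"
      using n by (simp add: w_def cmod_def power_divide)
    \<comment> \<open>Dropping the square root is crude but still leaves (1 + 1/n)^n, which is at
      most e.\<close>
    also have "\<dots> \<le> 1 + 1 / real n"
      by (rule real_le_lsqrt) (auto simp: power2_eq_square distrib_left)
    finally show "cmod (1 + of_real (x j) * w) \<le> 1 + 1 / real n" .
  qed simp
  also have "\<dots> \<le> exp 1"
    using one_plus_power_le_exp[of "1 / real n" n] n by simp
  finally show ?thesis .
qed

text \<open>Rankin's trick: the weight e^(card S - d) is at least 1 on the tail, and with it the sum
  over all subsets is (1 + e / sqrt n)^n e^(-d), at most exp (e sqrt n - d).\<close>

lemma riesz_tail_le:
  assumes d: "3 * sqrt (real n) \<le> real d" and n: "n > 0"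
  shows "(\<Sum>S\<in>{S. S \<subseteq> {1..n} \<and> d < card S}. \<bar>riesz n S\<bar>) \<le> 1"
proof -
  let ?t = "exp 1 / sqrt (real n)"
  have "(\<Sum>S\<in>{S. S \<subseteq> {1..n} \<and> d < card S}. \<bar>riesz n S\<bar>)
      \<le> (\<Sum>S\<in>{S. S \<subseteq> {1..n} \<and> d < card S}. ?t ^ card S / exp (real d))"
  proof (rule sum_mono)
    fix S assume "S \<in> {S. S \<subseteq> {1..n} \<and> d < card S}"
    then have "1 \<le> exp (real (card S)) / exp (real d)" by simp
    then have "(1 / sqrt (real n)) ^ card S * 1
        \<le> (1 / sqrt (real n)) ^ card S * (exp (real (card S)) / exp (real d))"
      by (intro mult_left_mono) auto
    also have "\<dots> = ?t ^ card S / exp (real d)"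
      by (simp add: power_divide flip: exp_of_nat_mult)
    finally show "\<bar>riesz n S\<bar> \<le> ?t ^ card S / exp (real d)"
      using abs_riesz_le[of n S] by simp
  qed
  also have "\<dots> \<le> (\<Sum>S\<in>Pow {1..n}. ?t ^ card S / exp (real d))"
    by (rule sum_mono2) auto
  also have "\<dots> = (1 + ?t) ^ n / exp (real d)"
    by (simp add: sum_Pow_power_card flip: sum_divide_distrib)
  also have "\<dots> \<le> exp (real n * ?t) / exp (real d)"
    by (intro divide_right_mono one_plus_power_le_exp) auto
  also have "real n * ?t = exp 1 * sqrt (real n)"
    using n by (simp add: field_simps)
  also have "exp (exp 1 * sqrt (real n)) / exp (real d) \<le> 1"
  proof -
    \<comment> \<open>The constant 3 in the bound on d is an upper bound for e.\<close>
    have "exp 1 * sqrt (real n) \<le> 3 * sqrt (real n)"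
      using exp_le by (intro mult_right_mono) auto
    with d show ?thesis by simp
  qed
  finally show ?thesis .
qed

lemma abs_trunc_fun_le:
  assumes x: "x \<in> cube n" and d: "3 * sqrt (real n) \<le> real d" and n: "n > 0"
  shows "\<bar>trunc_fun n d x\<bar> \<le> exp 1 + 1"
proof -
  let ?H = "{S. S \<subseteq> {1..n} \<and> d < card S}"
  have "(\<Sum>S\<in>Pow {1..n}. chi S x * riesz n S) - trunc_fun n d x
      = (\<Sum>S\<in>Pow {1..n}. if d < card S then chi S x * riesz n S else 0)"
    unfolding trunc_fun_def sum_subtractf[symmetric] by (rule sum.cong) (auto simp: trunc_def)
  also have "\<dots> = (\<Sum>S\<in>?H. chi S x * riesz n S)"
    by (subst sum.inter_filter[symmetric]) (auto simp: Pow_def)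
  also have "\<bar>\<dots>\<bar> \<le> (\<Sum>S\<in>?H. \<bar>chi S x * riesz n S\<bar>)"
    by (rule sum_abs)
  also have "\<dots> = (\<Sum>S\<in>?H. \<bar>riesz n S\<bar>)"
    by (rule sum.cong) (auto simp: abs_mult abs_chi[OF x])
  also have "\<dots> \<le> 1"
    by (rule riesz_tail_le[OF d n])
  finally show ?thesis
    using abs_riesz_product_le[OF x n] by linarith
qed

section \<open>The size of the spectrum\<close>

text \<open>Rankin's trick in the other direction: on sets of size at most d the weight n^(-card S)
  is at least n^(-d).\<close>

lemma card_low_degree_le:
  assumes n: "n > 0"
  shows "real (card {S. S \<subseteq> {1..n} \<and> card S \<le> d}) \<le> exp 1 * real n ^ d"
proof -
  let ?B = "{S. S \<subseteq> {1..n} \<and> card S \<le> d}"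
  have "real (card ?B) / real n ^ d = (\<Sum>S\<in>?B. (1 / real n) ^ d)"
    by (simp add: power_divide)
  also have "\<dots> \<le> (\<Sum>S\<in>?B. (1 / real n) ^ card S)"
    using n by (intro sum_mono power_decreasing) auto
  also have "\<dots> \<le> (\<Sum>S\<in>Pow {1..n}. (1 / real n) ^ card S)"
    by (rule sum_mono2) auto
  also have "\<dots> = (1 + 1 / real n) ^ n"
    by (simp add: sum_Pow_power_card)
  also have "\<dots> \<le> exp 1"
    using one_plus_power_le_exp[of "1 / real n" n] n by simp
  finally show ?thesis
    using n by (simp add: divide_le_eq)
qed

text \<open>Supplies the hypothesis ln n \<le> L of \<open>div_ln_le\<close>, where L is the
  logarithm of the size of the spectrum.\<close>

lemma card_spectrum_ge:
  assumes "\<And>j. j \<in> {1..n} \<Longrightarrow> fourier n F {j} \<noteq> 0"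
  shows "n \<le> card (spectrum n F)"
proof -
  have "card ((\<lambda>j. {j}) ` {1..n}) \<le> card (spectrum n F)"
    using assms by (intro card_mono) (auto simp: spectrum_def)
  then show ?thesis by (simp add: card_image)
qed

text \<open>
  \<open>L / ln L\<close> is not monotone near \<open>1\<close>, where it blows up, so for \<open>L \<le> sqrt n\<close> one uses
  \<open>ln L \<ge> ln (ln 3)\<close>.
\<close>

lemma div_ln_le:
  fixes L :: real
  assumes n: "n \<ge> 3" and lower: "ln (real n) \<le> L" and upper: "L \<le> 5 * sqrt (real n) * ln (real n)"
  shows "min (ln (ln 3)) (1 / 10) * (L / ln L) \<le> sqrt (real n)"
proof -
  have ln3: "ln 3 \<le> ln (real n)" using n by simp
  have L1: "1 < L" and lnL: "ln (ln 3) \<le> ln L" and pos: "0 < ln (ln 3 :: real)" and lnL0: "0 < ln L"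
    using ln3 lower ln3_gt_1 by auto
  show ?thesis
  proof (cases "L \<le> sqrt (real n)")
    case True
    have "min (ln (ln 3)) (1 / 10) * (L / ln L) \<le> ln L * (L / ln L)"
      using L1 lnL0 min.coboundedI1[OF lnL] by (intro mult_right_mono) auto
    then show ?thesis using True lnL0 by simp
  next
    case False
    \<comment> \<open>Above sqrt n, ln L controls ln n up to a factor 2, which cancels the ln n in
      \<open>upper\<close>; the constant 10 is 5 times 2.\<close>
    have "ln (real n) / 2 = ln (sqrt (real n))"
      using n by (simp add: ln_sqrt)
    also have "\<dots> \<le> ln L"
      using False n L1 by simp
    finally have "ln (real n) \<le> 2 * ln L" by simp
    then have "5 * sqrt (real n) * ln (real n) \<le> 5 * sqrt (real n) * (2 * ln L)"
      by (intro mult_left_mono) auto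
    with upper have "L \<le> 10 * sqrt (real n) * ln L" by linarith
    then have "L / ln L \<le> 10 * sqrt (real n)"
      using lnL0 by (simp add: divide_le_eq)
    then have "1 / 10 * (L / ln L) \<le> sqrt (real n)" by simp
    moreover have "min (ln (ln 3)) (1 / 10) * (L / ln L) \<le> 1 / 10 * (L / ln L)"
      using L1 lnL0 by (intro mult_right_mono) auto
    ultimately show ?thesis by linarith
  qed
qed

lemma ln_card_spectrum_trunc_fun_le:
  assumes n: "n \<ge> 3" and d: "real d \<le> 4 * sqrt (real n)"
    and ne: "spectrum n (trunc_fun n d) \<noteq> {}"
  shows "ln (real (card (spectrum n (trunc_fun n d)))) \<le> 5 * sqrt (real n) * ln (real n)"
proof -
  let ?K = "card (spectrum n (trunc_fun n d))"
  have "?K \<le> card {S. S \<subseteq> {1..n} \<and> card S \<le> d}"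
    by (rule card_mono) (auto simp: spectrum_def fourier_trunc_fun trunc_def split: if_splits)
  then have "real ?K \<le> exp 1 * real n ^ d"
    using card_low_degree_le[of n d] n by linarith
  moreover have "0 < real ?K" using ne by (simp add: card_gt_0_iff)
  ultimately have "ln (real ?K) \<le> ln (exp 1 * real n ^ d)"
    using n by (subst ln_le_cancel_iff) auto
  also have "\<dots> = 1 + real d * ln (real n)"
    using n by (simp add: ln_mult ln_realpow)
  \<comment> \<open>The constant 5 is 4 from the bound on d plus 1 to absorb the term ln e =
    1.\<close>
  also have "\<dots> \<le> sqrt (real n) * ln (real n) + 4 * sqrt (real n) * ln (real n)"
  proof (rule add_mono)
    have "1 \<le> ln (real n)" using ln3_gt_1 ln_le_cancel_iff[of 3 "real n"] n by linarith
    moreover have "1 \<le> sqrt (real n)" using n by simp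
    ultimately show "1 \<le> sqrt (real n) * ln (real n)" using mult_mono[of 1 _ 1] by fastforce
    show "real d * ln (real n) \<le> 4 * sqrt (real n) * ln (real n)"
      using d n by (intro mult_right_mono) auto
  qed
  finally show ?thesis by simp
qed

section \<open>Choice of the degree and the constants\<close>

theorem mainTheorem3:
  shows "\<exists>c C :: real. c > 0 \<and> C > 0 \<and>
    (\<forall>n::nat. n \<ge> 3 \<longrightarrow> (\<exists>F :: (nat \<Rightarrow> real) \<Rightarrow> real.
      (let \<F> = spectrum n F; f = spec_map n F in
        (\<forall>j\<in>{1..n}. fourier n F {j} = 1 / sqrt (real n)) \<and>
        (\<forall>x\<in>cube n.
          spec_norm n \<F> (f x) = Max ((\<lambda>z. \<bar>F z\<bar>) ` cube n) \<and>
          Max ((\<lambda>z. \<bar>F z\<bar>) ` cube n) \<le> C \<and>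
          spec_norm n \<F> (linear_part n f x) \<ge> sqrt (real n) \<and>
          sqrt (real n) \<ge> c * (ln (real (card \<F>)) / ln (ln (real (card \<F>))))))))"
proof (intro exI conjI allI impI)
  show "0 < min (ln (ln 3)) (1 / 10 :: real)" using ln3_gt_1 by simp
  show "0 < exp 1 + (1::real)" by (simp add: add_pos_pos)
  fix n :: nat assume n: "n \<ge> 3"
  define d where "d = nat \<lceil>3 * sqrt (real n)\<rceil>"
  have sqrt1: "1 \<le> sqrt (real n)" using n by simp
  have d: "3 * sqrt (real n) \<le> real d" unfolding d_def by (rule real_nat_ceiling_ge)
  \<comment> \<open>Rounding up costs at most 1, which is at most sqrt n.\<close>
  have d': "real d \<le> 4 * sqrt (real n)"
    using sqrt1 of_int_ceiling_le_add_one[of "3 * sqrt (real n)"] unfolding d_def by linarith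
  define F where "F = trunc_fun n d"
  \<comment> \<open>Truncation at degree at least 1 leaves the singleton coefficients
    untouched.\<close>
  have "1 \<le> d" using d sqrt1 by linarith
  then have lin: "fourier n F {j} = 1 / sqrt (real n)" if "j \<in> {1..n}" for j
    using that by (auto simp: F_def fourier_trunc_fun trunc_def riesz_singleton)
  have card: "n \<le> card (spectrum n F)"
    using n by (intro card_spectrum_ge) (simp add: lin)
  then have ne: "spectrum n F \<noteq> {}" using n by auto
  have "(\<Sum>j=1..n. fourier n F {j}) = sqrt (real n)"
    using n by (simp add: lin real_div_sqrt)
  then have norm: "sqrt (real n) \<le> spec_norm n (spectrum n F) (linear_part n (spec_map n F) x)"
    if "x \<in> cube n" for x
    using spec_norm_linear_part_spec_map_ge[OF that, of F] by linarith
  have bound: "Max ((\<lambda>z. \<bar>F z\<bar>) ` cube n) \<le> exp 1 + 1"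
    using n by (auto simp: F_def intro!: abs_trunc_fun_le d)
  have "min (ln (ln 3)) (1 / 10) * (ln (real (card (spectrum n F)))
      / ln (ln (real (card (spectrum n F))))) \<le> sqrt (real n)"
    using n card ne d' by (intro div_ln_le) (auto simp: F_def intro!: ln_card_spectrum_trunc_fun_le)
  then show "let \<F> = spectrum n F; f = spec_map n F in
        (\<forall>j\<in>{1..n}. fourier n F {j} = 1 / sqrt (real n)) \<and>
        (\<forall>x\<in>cube n.
          spec_norm n \<F> (f x) = Max ((\<lambda>z. \<bar>F z\<bar>) ` cube n) \<and>
          Max ((\<lambda>z. \<bar>F z\<bar>) ` cube n) \<le> exp 1 + 1 \<and>
          spec_norm n \<F> (linear_part n f x) \<ge> sqrt (real n) \<and>
          sqrt (real n) \<ge> min (ln (ln 3)) (1 / 10) * (ln (real (card \<F>)) / ln (ln (real (card \<F>)))))"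
    using lin bound norm by (simp add: spec_norm_spec_map Let_def)
qed

end
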